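(* Let $n\ge 1$ and let $\mathcal{R}$ denote Green's $\mathcal{R}$-relation on the multiplicative semigroup $(A^+(B_n),\circ)$. For $f,g\in A^+(B_n)$: (1) if $f,g\in\mathcal{C}_{B_n}$, then $f\,\mathcal{R}\,g$; (2) if $f,g\notin\mathcal{C}_{B_n}$, then $f\,\mathcal{R}\,g$ if and only if $\mathrm{supp}(f)=\mathrm{supp}(g)$. Moreover, for $n\ge 2$, the number of $\mathcal{R}$-classes in $(A^+(B_n),\circ)$ is $n^2+n+1$.
   Context: For $n\ge 1$ let $[n]=\{1,\dots,n\}$. The Brandt semigroup $(B_n,+)$ has underlying set $B_n=([n]\times[n])\cup\{\vartheta\}$ with $(i,j)+(k,l)=(i,l)$ if $j=k$, $(i,j)+(k,l)=\vartheta$ if $j\ne k$, and $\alpha+\vartheta=\vartheta+\alpha=\vartheta$ for all $\alpha\in B_n$. $M(B_n)$ is the set of all maps $B_n\to B_n$; arguments are written on the left of functions. It carries pointwise addition $\alpha(f+g)=\alpha f+\alpha g$ and composition $\alpha(f\circ g)=(\alpha f)g$ (so in $f\circ g$ the map $f$ is applied first; Green's relations are taken with respect to this product). An affine map over $B_n$ is a map of the form $g+h$ with $g$ an endomorphism of the semigroup $(B_n,+)$ (not required to fix $\vartheta$) and $h\in M(B_n)$ a constant map. $A^+(B_n)$ (the affine near-semiring over $B_n$) is the smallest subset of $M(B_n)$ that contains all affine maps and is closed under $+$ and $\circ$. $\mathcal{C}_{B_n}$ is the set of all constant maps on $B_n$ (including the one with value $\vartheta$). The support of $f\in M(B_n)$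 is $\mathrm{supp}(f)=\{\alpha\in B_n : \alpha f\neq\vartheta\}$. *)

theory Defs
  imports Main "HOL-Library.FuncSet"
begin

datatype brandt_elem = Theta | Pr nat nat

definition brandt :: "nat \<Rightarrow> brandt_elem set" where
  "brandt n = insert Theta {Pr i j |i j. i \<in> {1..n} \<and> j \<in> {1..n}}"

fun brandt_add :: "brandt_elem \<Rightarrow> brandt_elem \<Rightarrow> brandt_elem" (infixl "\<oplus>" 65) where
  "Pr i j \<oplus> Pr k l = (if j = k then Pr i l else Theta)"
| "Theta \<oplus> b = Theta"
| "a \<oplus> Theta = Theta"

text \<open>Maps are represented as extensional functions on the carrier, so that equality of
  functions coincides with equality of maps.\<close>

definition brandt_maps :: "nat \<Rightarrow> (brandt_elem \<Rightarrow> brandt_elem) set" where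
  "brandt_maps n = brandt n \<rightarrow>\<^sub>E brandt n"

definition map_add ::
  "nat \<Rightarrow> (brandt_elem \<Rightarrow> brandt_elem) \<Rightarrow> (brandt_elem \<Rightarrow> brandt_elem) \<Rightarrow> brandt_elem \<Rightarrow> brandt_elem" where
  "map_add n f g = (\<lambda>a\<in>brandt n. f a \<oplus> g a)"

text \<open>Arguments are written on the left in the source: in the product of \<open>f\<close> and \<open>g\<close>,
  the map \<open>f\<close> is applied first, the opposite of the argument order of \<^const>\<open>compose\<close>.\<close>

definition map_comp_left ::
  "nat \<Rightarrow> (brandt_elem \<Rightarrow> brandt_elem) \<Rightarrow> (brandt_elem \<Rightarrow> brandt_elem) \<Rightarrow> brandt_elem \<Rightarrow> brandt_elem" where
  "map_comp_left n f g = compose (brandt n) g f"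

definition brandt_endos :: "nat \<Rightarrow> (brandt_elem \<Rightarrow> brandt_elem) set" where
  "brandt_endos n =
    {g \<in> brandt_maps n. \<forall>a\<in>brandt n. \<forall>b\<in>brandt n. g (a \<oplus> b) = g a \<oplus> g b}"

definition const_maps :: "nat \<Rightarrow> (brandt_elem \<Rightarrow> brandt_elem) set" where
  "const_maps n = {\<lambda>a\<in>brandt n. c |c. c \<in> brandt n}"

definition affine_maps :: "nat \<Rightarrow> (brandt_elem \<Rightarrow> brandt_elem) set" where
  "affine_maps n = {map_add n g h |g h. g \<in> brandt_endos n \<and> h \<in> const_maps n}"

inductive_set affine_nsr :: "nat \<Rightarrow> (brandt_elem \<Rightarrow> brandt_elem) set" for n :: nat where
  affine: "f \<in> affine_maps n \<Longrightarrow> f \<in> affine_nsr n"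
| add: "f \<in> affine_nsr n \<Longrightarrow> g \<in> affine_nsr n \<Longrightarrow> map_add n f g \<in> affine_nsr n"
| comp: "f \<in> affine_nsr n \<Longrightarrow> g \<in> affine_nsr n \<Longrightarrow> map_comp_left n f g \<in> affine_nsr n"

definition map_supp :: "nat \<Rightarrow> (brandt_elem \<Rightarrow> brandt_elem) \<Rightarrow> brandt_elem set" where
  "map_supp n f = {a \<in> brandt n. f a \<noteq> Theta}"

text \<open>The principal right ideal \<open>a S\<^sup>1\<close> of a semigroup with carrier \<open>S\<close>; adjoining an identity
  to \<open>S\<close> amounts to inserting \<open>a\<close> itself.\<close>

definition principal_right_ideal :: "'a set \<Rightarrow> ('a \<Rightarrow> 'a \<Rightarrow> 'a) \<Rightarrow> 'a \<Rightarrow> 'a set" where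
  "principal_right_ideal S mul a = insert a (mul a ` S)"

definition greens_R :: "'a set \<Rightarrow> ('a \<Rightarrow> 'a \<Rightarrow> 'a) \<Rightarrow> ('a \<times> 'a) set" where
  "greens_R S mul = {(a, b). a \<in> S \<and> b \<in> S \<and>
     principal_right_ideal S mul a = principal_right_ideal S mul b}"

definition affine_R :: "nat \<Rightarrow> ((brandt_elem \<Rightarrow> brandt_elem) \<times> (brandt_elem \<Rightarrow> brandt_elem)) set" where
  "affine_R n = greens_R (affine_nsr n) (map_comp_left n)"

end

(* Endomorphisms of the Brandt semigroup are constant or induced by a permutation. Hence every
   element of the affine near-semiring is constant or fixes Theta and acts by a permutation s of
   {1..n} as (i, k) |-> (s i, q) on its support, which is a full column or a single point of it.
   Composing on the right with a map fixing Theta only shrinks the support, while two non-constant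
   maps (A, k, q, s) and (A, k, r, t) with the same support differ by the right factor that sends
   the whole column q to column r through the permutation t s^-1. *)

theory Submission
  imports Defs "HOL-Combinatorics.Permutations"
begin

section \<open>Column maps\<close>

definition column_map ::
  "nat \<Rightarrow> nat set \<Rightarrow> nat \<Rightarrow> nat \<Rightarrow> (nat \<Rightarrow> nat) \<Rightarrow> brandt_elem \<Rightarrow> brandt_elem" where
  "column_map n A k q s = (\<lambda>a\<in>brandt n. case a of
     Theta \<Rightarrow> Theta
   | Pr i j \<Rightarrow> if j = k \<and> i \<in> A then Pr (s i) q else Theta)"

definition full_or_subsingleton :: "nat \<Rightarrow> nat set \<Rightarrow> bool" where
  "full_or_subsingleton n A \<longleftrightarrow> A = {1..n} \<or> A = {} \<or> (\<exists>i\<in>{1..n}. A = {i})"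

text \<open>The row map \<open>s\<close> permutes all of \<open>{1..n}\<close> even when
  \<open>A\<close> is a single row. Products then simply compose permutations, but one map may have
  several descriptions.\<close>

definition column_maps :: "nat \<Rightarrow> (brandt_elem \<Rightarrow> brandt_elem) set" where
  "column_maps n = {column_map n A k q s |A k q s.
     full_or_subsingleton n A \<and> k \<in> {1..n} \<and> q \<in> {1..n} \<and> s permutes {1..n}}"

lemma Theta_in_brandt [simp]: "Theta \<in> brandt n"
  by (simp add: brandt_def)

lemma Pr_in_brandt [simp]: "Pr i j \<in> brandt n \<longleftrightarrow> i \<in> {1..n} \<and> j \<in> {1..n}"
  by (auto simp: brandt_def)

lemma add_Theta_right [simp]: "a \<oplus> Theta = Theta"
  by (cases a) auto

lemma add_in_brandt: "a \<in> brandt n \<Longrightarrow> b \<in> brandt n \<Longrightarrow> a \<oplus> b \<in> brandt n"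
  by (cases a; cases b) auto

lemma full_or_subsingleton_subset: "full_or_subsingleton n A \<Longrightarrow> A \<subseteq> {1..n}"
  by (auto simp: full_or_subsingleton_def)

lemma full_or_subsingleton_Int:
  assumes "full_or_subsingleton n A" "full_or_subsingleton n B"
  shows "full_or_subsingleton n (A \<inter> B)"
  using assms by (auto simp: full_or_subsingleton_def)

lemma full_or_subsingleton_vimage:
  assumes "full_or_subsingleton n A" and s: "s permutes {1..n}"
  shows "full_or_subsingleton n (s -` A)"
proof -
  consider "A = {1..n}" | "A = {}" | i where "i \<in> {1..n}" "A = {i}"
    using assms(1) by (auto simp: full_or_subsingleton_def)
  then show ?thesis
  proof cases
    case 1
    then show ?thesis using permutes_vimage[OF s] by (simp add: full_or_subsingleton_def)
  next
    case 2
    then show ?thesis by (simp add: full_or_subsingleton_def)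
  next
    case (3 i)
    have "s -` {i} = {inv s i}"
      using permutes_inverses[OF s] by force
    moreover have "inv s i \<in> {1..n}"
      using permutes_in_image[OF permutes_inv[OF s]] 3 by blast
    ultimately show ?thesis
      using 3 by (auto simp: full_or_subsingleton_def)
  qed
qed

lemma full_or_subsingleton_singleton:
  "i \<in> {1..n} \<Longrightarrow> full_or_subsingleton n {i}"
  by (auto simp: full_or_subsingleton_def)

lemma column_map_Theta [simp]: "column_map n A k q s Theta = Theta"
  by (simp add: column_map_def)

lemma column_map_Pr:
  "i \<in> {1..n} \<Longrightarrow> j \<in> {1..n} \<Longrightarrow>
    column_map n A k q s (Pr i j) = (if j = k \<and> i \<in> A then Pr (s i) q else Theta)"
  by (simp add: column_map_def)

lemma brandt_map_eqI:
  assumes "f \<in> extensional (brandt n)" "g \<in> extensional (brandt n)" "f Theta = g Theta"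
    and "\<And>i j. i \<in> {1..n} \<Longrightarrow> j \<in> {1..n} \<Longrightarrow> f (Pr i j) = g (Pr i j)"
  shows "f = g"
proof (rule extensionalityI[OF assms(1,2)])
  fix a assume "a \<in> brandt n"
  then show "f a = g a" using assms(3,4) by (cases a) auto
qed

lemma column_map_extensional [simp]: "column_map n A k q s \<in> extensional (brandt n)"
  by (simp add: column_map_def)

lemma map_add_extensional [simp]: "map_add n f g \<in> extensional (brandt n)"
  by (simp add: map_add_def)

lemma map_comp_left_extensional [simp]: "map_comp_left n f g \<in> extensional (brandt n)"
  by (simp add: map_comp_left_def compose_def)

lemma map_add_apply [simp]: "a \<in> brandt n \<Longrightarrow> map_add n f g a = f a \<oplus> g a"
  by (simp add: map_add_def)

lemma map_comp_left_apply [simp]: "a \<in> brandt n \<Longrightarrow> map_comp_left n f g a = g (f a)"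
  by (simp add: map_comp_left_def compose_def)

lemma const_mapsI: "c \<in> brandt n \<Longrightarrow> (\<lambda>a\<in>brandt n. c) \<in> const_maps n"
  by (auto simp: const_maps_def)

lemma column_map_empty: "column_map n {} k q s = (\<lambda>a\<in>brandt n. Theta)"
  by (rule brandt_map_eqI[of _ n]) (auto simp: column_map_Pr)

lemma const_maps_subset: "const_maps n \<subseteq> brandt_maps n"
  by (auto simp: const_maps_def brandt_maps_def)

lemma column_maps_subset: "column_maps n \<subseteq> brandt_maps n"
proof
  fix f assume "f \<in> column_maps n"
  then obtain A k q s where f: "f = column_map n A k q s"
    and q: "q \<in> {1..n}" and s: "s permutes {1..n}"
    by (auto simp: column_maps_def)
  have "f a \<in> brandt n" if "a \<in> brandt n" for a
    using that q permutes_in_image[OF s]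
    by (cases a) (auto simp: f column_map_Pr)
  then show "f \<in> brandt_maps n"
    unfolding brandt_maps_def PiE_def by (auto simp: f)
qed

lemma column_mapsI:
  "\<lbrakk>full_or_subsingleton n A; k \<in> {1..n}; q \<in> {1..n}; s permutes {1..n}\<rbrakk>
    \<Longrightarrow> column_map n A k q s \<in> column_maps n"
  by (auto simp: column_maps_def)

lemma column_mapsE:
  assumes "f \<in> column_maps n"
  obtains A k q s where "f = column_map n A k q s" "full_or_subsingleton n A"
    "k \<in> {1..n}" "q \<in> {1..n}" "s permutes {1..n}"
  using assms by (auto simp: column_maps_def)

section \<open>Endomorphisms and affine maps\<close>

text \<open>The image of \<open>Theta\<close> is idempotent. If it is nonzero, it forces every value
  to equal it. If it is \<open>Theta\<close>, either some pair is killed and then all are, or the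
  nonzero idempotents \<open>Pr i i\<close> are permuted among themselves and determine the
  map.\<close>

lemma brandt_endos_cases:
  assumes g: "g \<in> brandt_endos n"
  obtains (const) "g \<in> const_maps n"
  | (perm) s where "s permutes {1..n}" "g Theta = Theta"
      "\<And>i j. i \<in> {1..n} \<Longrightarrow> j \<in> {1..n} \<Longrightarrow> g (Pr i j) = Pr (s i) (s j)"
proof -
  have ext: "g \<in> extensional (brandt n)" and car: "\<And>a. a \<in> brandt n \<Longrightarrow> g a \<in> brandt n"
    and hom: "\<And>a b. a \<in> brandt n \<Longrightarrow> b \<in> brandt n \<Longrightarrow> g (a \<oplus> b) = g a \<oplus> g b"
    using g by (auto simp: brandt_endos_def brandt_maps_def PiE_def)
  have const_if: "g \<in> const_maps n" if "c \<in> brandt n" "\<And>a. a \<in> brandt n \<Longrightarrow> g a = c" for c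
  proof -
    have "g = (\<lambda>a\<in>brandt n. c)"
      using that by (intro extensionalityI[OF ext]) auto
    then show ?thesis using that(1) by (simp add: const_mapsI)
  qed
  show thesis
  proof (cases "g Theta")
    case (Pr p q)
    have idem: "Pr p q \<oplus> Pr p q = Pr p q"
      using hom[of Theta Theta] Pr by simp
    then have "p = q" by (auto split: if_splits)
    have "g a = Pr p p" if "a \<in> brandt n" for a
      using hom[OF that Theta_in_brandt] hom[OF Theta_in_brandt that] Pr \<open>p = q\<close>
      by (cases "g a") (auto split: if_splits)
    moreover have "Pr p p \<in> brandt n"
      using car[of Theta] Pr \<open>p = q\<close> by simp
    ultimately show thesis by (intro const const_if)
  next
    case Theta
    show thesis
    proof (cases "\<exists>i\<in>{1..n}. \<exists>j\<in>{1..n}. g (Pr i j) = Theta")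
      case True
      then obtain i j where ij: "i \<in> {1..n}" "j \<in> {1..n}" "g (Pr i j) = Theta" by blast
      have "g a = Theta" if "a \<in> brandt n" for a
      proof (cases a)
        case (Pr k l)
        then have kl: "k \<in> {1..n}" "l \<in> {1..n}" using that by auto
        \<comment> \<open>\<open>Pr k l\<close> factors as
          \<open>Pr k i \<oplus> Pr i j \<oplus> Pr j l\<close>, so killing \<open>Pr i j\<close>
          kills every pair.\<close>
        have "g (Pr k j) = Theta"
          using hom[of "Pr k i" "Pr i j"] kl ij by simp
        then show ?thesis
          using hom[of "Pr k j" "Pr j l"] kl ij Pr by simp
      qed (use Theta in simp)
      then show thesis by (intro const const_if[of Theta]) simp_all
    next
      case False
      \<comment> \<open>The row of the idempotent \<open>g (Pr i i)\<close> is read off. The value 0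
        never occurs on \<open>{1..n}\<close> in this case, and the identity outside is what
        \<open>permutes\<close> demands.\<close>
      define s where "s i = (if i \<in> {1..n} then (case g (Pr i i) of Pr p q \<Rightarrow> p | Theta \<Rightarrow> 0) else i)" for i
      have diag: "g (Pr i i) = Pr (s i) (s i)" if "i \<in> {1..n}" for i
      proof -
        have nz: "g (Pr i i) \<noteq> Theta" using False that by blast
        have "g (Pr i i) \<oplus> g (Pr i i) = g (Pr i i)"
          using hom[of "Pr i i" "Pr i i"] that by simp
        then show ?thesis
          using nz that by (cases "g (Pr i i)") (auto simp: s_def split: if_splits)
      qed
      have form: "g (Pr i j) = Pr (s i) (s j)" if "i \<in> {1..n}" "j \<in> {1..n}" for i j
      proof -
        have nz: "g (Pr i j) \<noteq> Theta" using False that by blast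
        \<comment> \<open>\<open>Pr i i\<close> and \<open>Pr j j\<close> are left and right
          identities of \<open>Pr i j\<close>; their images pin down both coordinates of its
          image.\<close>
        have fix_i: "Pr (s i) (s i) \<oplus> g (Pr i j) = g (Pr i j)"
          and fix_j: "g (Pr i j) \<oplus> Pr (s j) (s j) = g (Pr i j)"
          using hom[of "Pr i i" "Pr i j"] hom[of "Pr i j" "Pr j j"] that diag[of i] diag[of j]
          by simp_all
        obtain p q where pq: "g (Pr i j) = Pr p q" using nz by (cases "g (Pr i j)") auto
        have "p = s i" by (rule ccontr) (use fix_i pq in simp)
        moreover have "q = s j" by (rule ccontr) (use fix_j pq in simp)
        ultimately show ?thesis using pq by simp
      qed
      \<comment> \<open>Distinct idempotents \<open>Pr i i\<close> and \<open>Pr j j\<close> sum to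
        \<open>Theta\<close>, whereas equal images would sum to a nonzero element.\<close>
      have "inj_on s {1..n}"
      proof (rule inj_onI, rule ccontr)
        fix i j assume ij: "i \<in> {1..n}" "j \<in> {1..n}" "s i = s j" "i \<noteq> j"
        then have "g (Pr i i \<oplus> Pr j j) = Pr (s i) (s i)"
          using hom[of "Pr i i" "Pr j j"] diag by simp
        then show False using ij Theta by simp
      qed
      moreover have "s ` {1..n} \<subseteq> {1..n}"
      proof (rule image_subsetI)
        fix i assume "i \<in> {1..n}"
        then show "s i \<in> {1..n}" using diag[of i] car[of "Pr i i"] by simp
      qed
      ultimately have "bij_betw s {1..n} {1..n}"
        by (simp add: bij_betw_def endo_inj_surj)
      then have "s permutes {1..n}"
        by (rule bij_imp_permutes) (auto simp: s_def)
      then show thesis using form Theta by (intro perm)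
    qed
  qed
qed

lemma map_add_const_const:
  "f \<in> const_maps n \<Longrightarrow> g \<in> const_maps n \<Longrightarrow> map_add n f g \<in> const_maps n"
proof -
  assume "f \<in> const_maps n" "g \<in> const_maps n"
  then obtain c d where *: "f = (\<lambda>a\<in>brandt n. c)" "g = (\<lambda>a\<in>brandt n. d)" "c \<in> brandt n" "d \<in> brandt n"
    by (auto simp: const_maps_def)
  have "map_add n f g = (\<lambda>a\<in>brandt n. c \<oplus> d)"
    by (rule brandt_map_eqI[of _ n]) (auto simp: *)
  then show ?thesis using * by (simp add: const_mapsI add_in_brandt)
qed

text \<open>Adding the constant \<open>Pr p q\<close> to the automorphism induced by
  \<open>s\<close> leaves a nonzero value at \<open>Pr i j\<close> only if \<open>s j = p\<close>.
  This singles out the column \<open>inv s p\<close>, with all its rows.\<close>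

lemma affine_maps_subset: "affine_maps n \<subseteq> const_maps n \<union> column_maps n"
proof
  fix f assume "f \<in> affine_maps n"
  then obtain g h where f: "f = map_add n g h" and g: "g \<in> brandt_endos n" and h: "h \<in> const_maps n"
    by (auto simp: affine_maps_def)
  obtain c where c: "h = (\<lambda>a\<in>brandt n. c)" "c \<in> brandt n"
    using h by (auto simp: const_maps_def)
  show "f \<in> const_maps n \<union> column_maps n"
    using g
  proof (cases rule: brandt_endos_cases)
    case const
    then show ?thesis using h f map_add_const_const by blast
  next
    case (perm s)
    show ?thesis
    proof (cases c)
      case Theta
      have "f = (\<lambda>a\<in>brandt n. Theta)"
        unfolding f by (rule brandt_map_eqI[of _ n]) (auto simp: c Theta)
      then show ?thesis by (simp add: const_mapsI)
    next
      case (Pr p q)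
      have pq: "p \<in> {1..n}" "q \<in> {1..n}" using c Pr by auto
      have s': "s j = p \<longleftrightarrow> j = inv s p" for j
        using permutes_inverses[OF perm(1)] by metis
      have "f = column_map n {1..n} (inv s p) q s"
        unfolding f using perm(2,3) by (intro brandt_map_eqI[of _ n]) (auto simp: c Pr column_map_Pr s')
      moreover have "inv s p \<in> {1..n}"
        using permutes_in_image[OF permutes_inv[OF perm(1)]] pq by blast
      ultimately show ?thesis
        using pq perm(1) by (auto intro!: column_mapsI simp: full_or_subsingleton_def)
    qed
  qed
qed

section \<open>Full column maps and constants as members of the near-semiring\<close>

text \<open>Already an affine map: the automorphism induced by \<open>s\<close> plus the constant
  \<open>Pr (s k) q\<close>, whose first coordinate selects column \<open>k\<close>.\<close>

lemma full_column_map_in_affine_nsr: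
  assumes k: "k \<in> {1..n}" and q: "q \<in> {1..n}" and s: "s permutes {1..n}"
  shows "column_map n {1..n} k q s \<in> affine_nsr n"
proof -
  define g where "g = (\<lambda>a\<in>brandt n. case a of Theta \<Rightarrow> Theta | Pr i j \<Rightarrow> Pr (s i) (s j))"
  have im: "s i \<in> {1..n} \<longleftrightarrow> i \<in> {1..n}" for i using permutes_in_image[OF s] .
  have inj: "s i = s j \<longleftrightarrow> i = j" for i j using permutes_inj[OF s] by (auto simp: inj_def)
  have g_apply: "g Theta = Theta"
    "\<And>i j. i \<in> {1..n} \<Longrightarrow> j \<in> {1..n} \<Longrightarrow> g (Pr i j) = Pr (s i) (s j)"
    by (simp_all add: g_def)
  have ga: "g a \<in> brandt n" if "a \<in> brandt n" for a
  proof (cases a)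
    case (Pr i j)
    then show ?thesis using that im[of i] im[of j] by (auto simp: g_def)
  qed (simp add: g_def)
  \<comment> \<open>Injectivity of \<open>s\<close> sends non-matching pairs to non-matching pairs,
    so sums equal to \<open>Theta\<close> are respected.\<close>
  have hom: "g (a \<oplus> b) = g a \<oplus> g b" if "a \<in> brandt n" "b \<in> brandt n" for a b
    using that by (cases a; cases b) (auto simp: g_apply inj)
  have "g \<in> brandt_maps n"
    unfolding brandt_maps_def PiE_def using ga by (auto simp: g_def)
  then have "g \<in> brandt_endos n"
    using hom by (simp add: brandt_endos_def)
  moreover have "(\<lambda>a\<in>brandt n. Pr (s k) q) \<in> const_maps n"
    using im[of k] k q by (intro const_mapsI) simp
  moreover have "column_map n {1..n} k q s = map_add n g (\<lambda>a\<in>brandt n. Pr (s k) q)"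
    by (rule brandt_map_eqI[of _ n]) (auto simp: column_map_Pr g_apply inj)
  ultimately show ?thesis
    by (intro affine_nsr.affine) (auto simp: affine_maps_def)
qed

text \<open>The constant map at an idempotent \<open>e\<close> is an endomorphism. Choosing
  \<open>e\<close> as a left identity of \<open>c\<close> makes the constant \<open>c\<close> an
  affine map.\<close>

lemma const_maps_subset_affine_nsr: "const_maps n \<subseteq> affine_nsr n"
proof
  fix f assume "f \<in> const_maps n"
  then obtain c where c: "f = (\<lambda>a\<in>brandt n. c)" "c \<in> brandt n" by (auto simp: const_maps_def)
  obtain e where e: "e \<in> brandt n" "e \<oplus> e = e" "e \<oplus> c = c"
  proof (cases c)
    case Theta
    then show ?thesis using that[of Theta] by simp
  next
    case (Pr p q)
    then show ?thesis using that[of "Pr p p"] c(2) by simp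
  qed
  have "(\<lambda>a\<in>brandt n. e) \<in> brandt_endos n"
    using e by (auto simp: brandt_endos_def brandt_maps_def add_in_brandt)
  moreover have "f = map_add n (\<lambda>a\<in>brandt n. e) f"
    by (rule brandt_map_eqI[of _ n]) (auto simp: c e)
  ultimately show "f \<in> affine_nsr n"
    using \<open>f \<in> const_maps n\<close> by (intro affine_nsr.affine) (auto simp: affine_maps_def)
qed

section \<open>Elements of the affine near-semiring\<close>

lemma map_add_const_column:
  assumes "f \<in> const_maps n" and "g \<in> column_maps n"
  shows "map_add n f g \<in> const_maps n \<union> column_maps n"
proof -
  obtain c where c: "f = (\<lambda>a\<in>brandt n. c)" "c \<in> brandt n"
    using assms(1) by (auto simp: const_maps_def)
  obtain A k r s where g: "g = column_map n A k r s" "full_or_subsingleton n A"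
    "k \<in> {1..n}" "r \<in> {1..n}" and s: "s permutes {1..n}"
    using assms(2) by (rule column_mapsE)
  show ?thesis
  proof (cases c)
    case Theta
    have "map_add n f g = (\<lambda>a\<in>brandt n. Theta)"
      by (rule brandt_map_eqI[of _ n]) (auto simp: c Theta)
    then show ?thesis by (simp add: const_mapsI)
  next
    case (Pr p q)
    have pq: "p \<in> {1..n}" "q \<in> {1..n}" using c Pr by auto
    \<comment> \<open>The sum survives only at the row with \<open>s i = q\<close>, where the value
      is \<open>Pr p r\<close>. Following \<open>s\<close> by the transposition of \<open>p\<close>
      and \<open>q\<close> gives a permutation with the right value at that row.\<close>
    have "map_add n f g = column_map n (A \<inter> s -` {q}) k r (transpose p q \<circ> s)"
      by (rule brandt_map_eqI[of _ n]) (auto simp: c Pr g(1) column_map_Pr)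
    moreover have "full_or_subsingleton n (A \<inter> s -` {q})"
      using g(2) pq s
      by (intro full_or_subsingleton_Int full_or_subsingleton_vimage full_or_subsingleton_singleton)
    moreover have "transpose p q \<circ> s permutes {1..n}"
      using pq by (intro permutes_compose[OF s] permutes_swap_id)
    ultimately show ?thesis using g by (auto intro: column_mapsI)
  qed
qed

text \<open>All nonzero values of a column map lie in one column \<open>q\<close>. A constant
  \<open>Pr q r\<close> moves them to column \<open>r\<close>; any other constant annihilates
  them.\<close>

lemma map_add_column_const:
  assumes "f \<in> column_maps n" and "g \<in> const_maps n"
  shows "map_add n f g \<in> const_maps n \<union> column_maps n"
proof -
  obtain c where c: "g = (\<lambda>a\<in>brandt n. c)" "c \<in> brandt n"
    using assms(2) by (auto simp: const_maps_def)
  obtain A k q s where f: "f = column_map n A k q s" "full_or_subsingleton n A"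
    "k \<in> {1..n}" "q \<in> {1..n}" and s: "s permutes {1..n}"
    using assms(1) by (rule column_mapsE)
  show ?thesis
  proof (cases "\<exists>r. c = Pr q r")
    case False
    have "map_add n f g = (\<lambda>a\<in>brandt n. Theta)"
    proof (rule brandt_map_eqI[of _ n])
      fix i j assume "i \<in> {1..n}" "j \<in> {1..n}"
      then show "map_add n f g (Pr i j) = (\<lambda>a\<in>brandt n. Theta) (Pr i j)"
        using False by (cases c) (auto simp: c(1) f(1) column_map_Pr)
    qed (auto simp: f(1))
    then show ?thesis by (simp add: const_mapsI)
  next
    case True
    then obtain r where r: "c = Pr q r" ..
    then have "map_add n f g = column_map n A k r s"
      by (intro brandt_map_eqI[of _ n]) (auto simp: c(1) f(1) column_map_Pr)
    moreover have "r \<in> {1..n}" using c r by simp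
    ultimately show ?thesis using f s by (auto intro: column_mapsI)
  qed
qed

text \<open>Supports in different columns give zero. In a common column the sum is nonzero only
  where \<open>t i = q\<close>, hence at no more than one row.\<close>

lemma map_add_column_column:
  assumes "f \<in> column_maps n" and "g \<in> column_maps n"
  shows "map_add n f g \<in> const_maps n \<union> column_maps n"
proof -
  obtain A k q s where f: "f = column_map n A k q s" "full_or_subsingleton n A"
    "k \<in> {1..n}" "q \<in> {1..n}" and s: "s permutes {1..n}"
    using assms(1) by (rule column_mapsE)
  obtain B l r t where g: "g = column_map n B l r t" "full_or_subsingleton n B"
    "l \<in> {1..n}" "r \<in> {1..n}" and t: "t permutes {1..n}"
    using assms(2) by (rule column_mapsE)
  show ?thesis
  proof (cases "k = l")
    case False
    then have "map_add n f g = (\<lambda>a\<in>brandt n. Theta)"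
      by (intro brandt_map_eqI[of _ n]) (auto simp: f(1) g(1) column_map_Pr)
    then show ?thesis by (simp add: const_mapsI)
  next
    case True
    then have "map_add n f g = column_map n (A \<inter> (B \<inter> t -` {q})) k r s"
      by (intro brandt_map_eqI[of _ n]) (auto simp: f(1) g(1) column_map_Pr)
    moreover have "full_or_subsingleton n (A \<inter> (B \<inter> t -` {q}))"
      using f g t
      by (intro full_or_subsingleton_Int full_or_subsingleton_vimage full_or_subsingleton_singleton)
    ultimately show ?thesis using f g s by (auto intro: column_mapsI)
  qed
qed

section \<open>Closure under composition and the shape of all elements\<close>

lemma map_comp_left_column_column:
  assumes f: "A \<subseteq> {1..n}" "q \<in> {1..n}" "s permutes {1..n}"
  shows "map_comp_left n (column_map n A k q s) (column_map n B q r t) =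
    column_map n (A \<inter> s -` B) k r (t \<circ> s)"
  using f permutes_in_image[OF f(3)]
  by (intro brandt_map_eqI[of _ n]) (auto simp: column_map_Pr)

lemma map_comp_left_const_right:
  assumes "f \<in> brandt_maps n" and "g \<in> const_maps n"
  shows "map_comp_left n f g \<in> const_maps n"
proof -
  obtain c where c: "g = (\<lambda>a\<in>brandt n. c)" "c \<in> brandt n"
    using assms(2) by (auto simp: const_maps_def)
  have "map_comp_left n f g = (\<lambda>a\<in>brandt n. c)"
    using assms(1) by (intro brandt_map_eqI[of _ n]) (auto simp: c brandt_maps_def PiE_def Pi_def)
  then show ?thesis using c by (simp add: const_mapsI)
qed

lemma map_comp_left_const_left:
  assumes "f \<in> const_maps n" and "g \<in> brandt_maps n"
  shows "map_comp_left n f g \<in> const_maps n"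
proof -
  obtain c where c: "f = (\<lambda>a\<in>brandt n. c)" "c \<in> brandt n"
    using assms(1) by (auto simp: const_maps_def)
  have "map_comp_left n f g = (\<lambda>a\<in>brandt n. g c)"
    by (rule brandt_map_eqI[of _ n]) (auto simp: c)
  moreover have "g c \<in> brandt n" using assms(2) c by (auto simp: brandt_maps_def)
  ultimately show ?thesis by (simp add: const_mapsI)
qed

lemma map_comp_left_closed:
  assumes f: "f \<in> const_maps n \<union> column_maps n" and g: "g \<in> const_maps n \<union> column_maps n"
  shows "map_comp_left n f g \<in> const_maps n \<union> column_maps n"
proof (cases "f \<in> const_maps n \<or> g \<in> const_maps n")
  case True
  then show ?thesis
    using f g map_comp_left_const_left map_comp_left_const_right
      const_maps_subset column_maps_subset by blast
next
  case False
  obtain A k q s where f': "f = column_map n A k q s" "full_or_subsingleton n A"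
    "k \<in> {1..n}" "q \<in> {1..n}" and s: "s permutes {1..n}"
    using f False by (auto elim: column_mapsE)
  obtain B l r t where g': "g = column_map n B l r t" "full_or_subsingleton n B"
    "l \<in> {1..n}" "r \<in> {1..n}" and t: "t permutes {1..n}"
    using g False by (auto elim: column_mapsE)
  show ?thesis
  proof (cases "q = l")
    case True
    have "full_or_subsingleton n (A \<inter> s -` B)"
      using f' g' s by (intro full_or_subsingleton_Int full_or_subsingleton_vimage)
    moreover have "map_comp_left n f g = column_map n (A \<inter> s -` B) k r (t \<circ> s)"
      unfolding f'(1) g'(1) True[symmetric]
      using f' s full_or_subsingleton_subset by (intro map_comp_left_column_column) auto
    ultimately show ?thesis
      using f' g' permutes_compose[OF s t] by (auto intro: column_mapsI)
  next
    case False
    \<comment> \<open>The nonzero values of \<open>f\<close> lie in column \<open>q\<close>, outside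
      the column \<open>l\<close> on which \<open>g\<close> lives.\<close>
    have "map_comp_left n f g = (\<lambda>a\<in>brandt n. Theta)"
      using False f' permutes_in_image[OF s]
      by (intro brandt_map_eqI[of _ n]) (auto simp: f'(1) g'(1) column_map_Pr)
    then show ?thesis by (simp add: const_mapsI)
  qed
qed

text \<open>Induction along the generation of the near-semiring: the union contains the affine maps
  and is closed under both operations.\<close>

lemma affine_nsr_subset: "affine_nsr n \<subseteq> const_maps n \<union> column_maps n"
proof
  fix f assume "f \<in> affine_nsr n"
  then show "f \<in> const_maps n \<union> column_maps n"
  proof induction
    case (affine f)
    then show ?case using affine_maps_subset by blast
  next
    case (add f g)
    then show ?case
      using map_add_const_const map_add_const_column map_add_column_const map_add_column_column
      by blast
  next
    case (comp f g)
    then show ?case by (intro map_comp_left_closed)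
  qed
qed

lemma affine_nsr_subset_brandt_maps: "affine_nsr n \<subseteq> brandt_maps n"
  using affine_nsr_subset const_maps_subset column_maps_subset by blast

lemma affine_nsr_nonconst_cases:
  assumes "f \<in> affine_nsr n" and "f \<notin> const_maps n"
  obtains A k q s where "f = column_map n A k q s" "A \<noteq> {}" "full_or_subsingleton n A"
    "k \<in> {1..n}" "q \<in> {1..n}" "s permutes {1..n}"
proof -
  have "f \<in> column_maps n" using assms affine_nsr_subset by blast
  then obtain A k q s where *: "f = column_map n A k q s" "full_or_subsingleton n A"
    "k \<in> {1..n}" "q \<in> {1..n}" "s permutes {1..n}"
    by (rule column_mapsE)
  moreover have "A \<noteq> {}"
    using assms(2) *(1) column_map_empty const_mapsI[of Theta] by auto
  ultimately show thesis using that by blast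
qed

section \<open>Green's relation\<close>

text \<open>Composites are evaluated only on the carrier, so \<open>f\<close> has to take its values
  there.\<close>

lemma map_comp_left_assoc:
  assumes "f \<in> brandt_maps n"
  shows "map_comp_left n (map_comp_left n f g) h = map_comp_left n f (map_comp_left n g h)"
  using assms by (intro extensionalityI[of _ "brandt n"]) (auto simp: brandt_maps_def PiE_def Pi_def)

text \<open>Equality of principal right ideals is mutual right divisibility; the alternative
  \<open>f = g\<close> accounts for the adjoined identity.\<close>

lemma affine_R_iff:
  assumes f: "f \<in> affine_nsr n" and g: "g \<in> affine_nsr n"
  shows "(f, g) \<in> affine_R n \<longleftrightarrow>
    f = g \<or> ((\<exists>h\<in>affine_nsr n. g = map_comp_left n f h) \<and>
            (\<exists>h\<in>affine_nsr n. f = map_comp_left n g h))"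
proof -
  let ?I = "principal_right_ideal (affine_nsr n) (map_comp_left n)"
  have sub: "?I (map_comp_left n u h) \<subseteq> ?I u" if "u \<in> affine_nsr n" "h \<in> affine_nsr n" for u h
  proof -
    have u: "u \<in> brandt_maps n" using that affine_nsr_subset_brandt_maps by blast
    then show ?thesis
      using that affine_nsr.comp
      by (auto simp: principal_right_ideal_def map_comp_left_assoc[OF u])
  qed
  show ?thesis
  proof
    assume "(f, g) \<in> affine_R n"
    then have "?I f = ?I g" by (simp add: affine_R_def greens_R_def)
    moreover have "f \<in> ?I f" "g \<in> ?I g" by (simp_all add: principal_right_ideal_def)
    ultimately have "f \<in> ?I g" "g \<in> ?I f" by simp_all
    then show "f = g \<or> ((\<exists>h\<in>affine_nsr n. g = map_comp_left n f h) \<and>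
            (\<exists>h\<in>affine_nsr n. f = map_comp_left n g h))"
      by (auto simp: principal_right_ideal_def)
  next
    assume "f = g \<or> ((\<exists>h\<in>affine_nsr n. g = map_comp_left n f h) \<and>
            (\<exists>h\<in>affine_nsr n. f = map_comp_left n g h))"
    then have "?I f = ?I g"
    proof
      assume "(\<exists>h\<in>affine_nsr n. g = map_comp_left n f h) \<and>
            (\<exists>h\<in>affine_nsr n. f = map_comp_left n g h)"
      then obtain h h' where "h \<in> affine_nsr n" "g = map_comp_left n f h"
        "h' \<in> affine_nsr n" "f = map_comp_left n g h'" by blast
      then show ?thesis using sub[OF f, of h] sub[OF g, of h'] by simp
    qed simp
    then show "(f, g) \<in> affine_R n"
      using f g by (simp add: affine_R_def greens_R_def)
  qed
qed

section \<open>Supports and right divisibility\<close>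

lemma map_supp_column_map:
  assumes "A \<subseteq> {1..n}" "k \<in> {1..n}"
  shows "map_supp n (column_map n A k q s) = (\<lambda>i. Pr i k) ` A"
proof (intro set_eqI)
  fix a
  show "a \<in> map_supp n (column_map n A k q s) \<longleftrightarrow> a \<in> (\<lambda>i. Pr i k) ` A"
    using assms by (cases a) (auto simp: map_supp_def column_map_Pr split: if_splits)
qed

text \<open>Constant maps are right zeros of one another: the factor applied last decides the
  product. Each is thus a right multiple of the other.\<close>

lemma const_maps_affine_R:
  assumes "f \<in> const_maps n" "g \<in> const_maps n"
  shows "(f, g) \<in> affine_R n"
proof -
  have mult: "map_comp_left n u v = v" if "u \<in> const_maps n" "v \<in> const_maps n" for u v
    using that by (intro extensionalityI[of _ "brandt n"]) (auto simp: const_maps_def)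
  have S: "f \<in> affine_nsr n" "g \<in> affine_nsr n"
    using assms const_maps_subset_affine_nsr by auto
  have "g = map_comp_left n f g" "f = map_comp_left n g f"
    using assms mult by simp_all
  then show ?thesis using affine_R_iff[OF S] S by blast
qed

text \<open>A right multiple of a constant map is again constant.\<close>

lemma affine_R_const_maps_iff:
  assumes "(f, g) \<in> affine_R n"
  shows "f \<in> const_maps n \<longleftrightarrow> g \<in> const_maps n"
proof -
  have S: "f \<in> affine_nsr n" "g \<in> affine_nsr n"
    using assms by (simp_all add: affine_R_def greens_R_def)
  then show ?thesis
    using assms affine_R_iff[OF S] map_comp_left_const_left affine_nsr_subset_brandt_maps
    by (metis subsetD)
qed

text \<open>A constant right factor would make the product constant. So \<open>h\<close> is a column
  map and fixes \<open>Theta\<close>, and points sent to \<open>Theta\<close> by \<open>f\<close>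
  remain there.\<close>

lemma map_supp_comp_left_subset:
  assumes "f \<in> affine_nsr n" "h \<in> affine_nsr n" "map_comp_left n f h \<notin> const_maps n"
  shows "map_supp n (map_comp_left n f h) \<subseteq> map_supp n f"
proof -
  have "f \<in> brandt_maps n" using assms(1) affine_nsr_subset_brandt_maps by blast
  then have "h \<notin> const_maps n" using assms(3) map_comp_left_const_right by blast
  then have "h Theta = Theta" by (rule affine_nsr_nonconst_cases[OF assms(2)]) simp
  then show ?thesis by (auto simp: map_supp_def)
qed

lemma same_map_supp_right_multiple:
  assumes f: "f \<in> affine_nsr n" "f \<notin> const_maps n" and g: "g \<in> affine_nsr n" "g \<notin> const_maps n"
    and supp: "map_supp n f = map_supp n g"
  shows "\<exists>h\<in>affine_nsr n. g = map_comp_left n f h"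
proof -
  obtain A k q s where f': "f = column_map n A k q s" "A \<noteq> {}" "full_or_subsingleton n A"
    "k \<in> {1..n}" "q \<in> {1..n}" and s: "s permutes {1..n}"
    using f by (rule affine_nsr_nonconst_cases)
  obtain B l r t where g': "g = column_map n B l r t" "B \<noteq> {}" "full_or_subsingleton n B"
    "l \<in> {1..n}" "r \<in> {1..n}" and t: "t permutes {1..n}"
    using g by (rule affine_nsr_nonconst_cases)
  have A: "A \<subseteq> {1..n}" and B: "B \<subseteq> {1..n}"
    using f' g' full_or_subsingleton_subset by auto
  have eq: "(\<lambda>i. Pr i k) ` A = (\<lambda>i. Pr i l) ` B"
    using supp A B f' g' by (simp add: map_supp_column_map)
  \<comment> \<open>Nonemptiness of \<open>A\<close> lets the common support reveal its
    column.\<close>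
  then have "k = l" using f'(2) by auto
  then have "A = B" using eq by auto
  \<comment> \<open>Column \<open>q\<close> receives the nonzero values of \<open>f\<close>. Taking
    all its rows loses none of them, and undoing \<open>s\<close> before applying \<open>t\<close>
    produces the values of \<open>g\<close>.\<close>
  let ?h = "column_map n {1..n} q r (t \<circ> inv s)"
  have "?h \<in> affine_nsr n"
    using f' g' by (intro full_column_map_in_affine_nsr permutes_compose permutes_inv s t)
  moreover have "map_comp_left n f ?h = column_map n (A \<inter> s -` {1..n}) k r (t \<circ> inv s \<circ> s)"
    unfolding f'(1) using A f' s by (intro map_comp_left_column_column)
  moreover have "s -` {1..n} = {1..n}" by (rule permutes_vimage[OF s])
  moreover have "t \<circ> inv s \<circ> s = t"
    using permutes_inverses[OF s] by (simp add: fun_eq_iff)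
  ultimately show ?thesis
    using A g'(1) \<open>k = l\<close> \<open>A = B\<close> by (metis Int_absorb2)
qed

lemma affine_R_iff_map_supp:
  assumes f: "f \<in> affine_nsr n" "f \<notin> const_maps n" and g: "g \<in> affine_nsr n" "g \<notin> const_maps n"
  shows "(f, g) \<in> affine_R n \<longleftrightarrow> map_supp n f = map_supp n g"
proof
  assume "(f, g) \<in> affine_R n"
  then show "map_supp n f = map_supp n g"
    unfolding affine_R_iff[OF f(1) g(1)]
    using map_supp_comp_left_subset f g by (metis subset_antisym)
next
  assume "map_supp n f = map_supp n g"
  then show "(f, g) \<in> affine_R n"
    unfolding affine_R_iff[OF f(1) g(1)]
    using same_map_supp_right_multiple f g by metis
qed

section \<open>Counting the classes\<close>

text \<open>\<open>R\<close> is the kernel of \<open>F\<close> on \<open>S\<close>, so its classes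
  are the fibres of \<open>F\<close>, one for each value attained.\<close>

lemma card_quotient_invariant:
  assumes "\<And>x y. (x, y) \<in> R \<longleftrightarrow> x \<in> S \<and> y \<in> S \<and> F x = F y"
  shows "card (S // R) = card (F ` S)"
proof -
  have "R `` {x} = {z \<in> S. F z = F x}" if "x \<in> S" for x
    using assms that by auto
  then have "S // R = (\<lambda>y. {x \<in> S. F x = y}) ` F ` S"
    unfolding quotient_def image_image UNION_singleton_eq_range by (rule image_cong[OF refl])
  \<comment> \<open>Fibres over attained values are nonempty, hence distinct values have distinct
    fibres.\<close>
  moreover have "inj_on (\<lambda>y. {x \<in> S. F x = y}) (F ` S)"
    by (rule inj_onI) blast
  ultimately show ?thesis by (simp add: card_image)
qed

text \<open>The value at constant maps is a junk set that is not the support of a non-constant element,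
  as those fix \<^const>\<open>Theta\<close>.\<close>

definition R_invariant :: "nat \<Rightarrow> (brandt_elem \<Rightarrow> brandt_elem) \<Rightarrow> brandt_elem set" where
  "R_invariant n f = (if f \<in> const_maps n then {Theta} else map_supp n f)"

lemma Theta_notin_map_supp:
  assumes "f \<in> affine_nsr n" "f \<notin> const_maps n"
  shows "Theta \<notin> map_supp n f"
  by (rule affine_nsr_nonconst_cases[OF assms]) (simp add: map_supp_def)

text \<open>This presents the relation as the kernel of one invariant, ready for counting. A
  constant and a non-constant map are separated because only the former's invariant contains
  \<open>Theta\<close>.\<close>

lemma affine_R_iff_R_invariant:
  "(f, g) \<in> affine_R n \<longleftrightarrow>
    f \<in> affine_nsr n \<and> g \<in> affine_nsr n \<and> R_invariant n f = R_invariant n g"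
proof (cases "f \<in> affine_nsr n \<and> g \<in> affine_nsr n")
  case True
  then have f: "f \<in> affine_nsr n" and g: "g \<in> affine_nsr n" by auto
  consider "f \<in> const_maps n" "g \<in> const_maps n" | "f \<notin> const_maps n" "g \<notin> const_maps n"
    | "f \<in> const_maps n \<longleftrightarrow> g \<notin> const_maps n"
    by blast
  then show ?thesis
  proof cases
    case 1
    then show ?thesis using f g const_maps_affine_R by (simp add: R_invariant_def)
  next
    case 2
    then show ?thesis using f g affine_R_iff_map_supp by (simp add: R_invariant_def)
  next
    case 3
    then have "R_invariant n f \<noteq> R_invariant n g"
      using Theta_notin_map_supp[OF f] Theta_notin_map_supp[OF g]
      by (cases "f \<in> const_maps n") (auto simp: R_invariant_def)
    then show ?thesis using 3 affine_R_const_maps_iff by blast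
  qed
next
  case False
  then show ?thesis by (auto simp: affine_R_def greens_R_def)
qed

text \<open>A constant map fixing \<open>Theta\<close> is zero everywhere and has empty
  support.\<close>

lemma map_supp_nonconst:
  assumes "f Theta = Theta" "map_supp n f \<noteq> {}"
  shows "f \<notin> const_maps n"
  using assms by (auto simp: const_maps_def map_supp_def)

lemma R_invariant_image:
  "R_invariant n ` affine_nsr n =
    insert {Theta} ((\<lambda>k. (\<lambda>i. Pr i k) ` {1..n}) ` {1..n} \<union> (\<lambda>(i, k). {Pr i k}) ` ({1..n} \<times> {1..n}))"
    (is "?L = insert _ (?C \<union> ?P)")
proof (intro equalityI subsetI)
  fix X assume "X \<in> ?L"
  then obtain f where f: "f \<in> affine_nsr n" "X = R_invariant n f" by blast
  show "X \<in> insert {Theta} (?C \<union> ?P)"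
  proof (cases "f \<in> const_maps n")
    case True
    then show ?thesis using f by (simp add: R_invariant_def)
  next
    case False
    with f(1) obtain A k q s where *: "f = column_map n A k q s" "A \<noteq> {}" "full_or_subsingleton n A"
      "k \<in> {1..n}"
      by (rule affine_nsr_nonconst_cases)
    then have "X = (\<lambda>i. Pr i k) ` A"
      using f False full_or_subsingleton_subset by (simp add: R_invariant_def map_supp_column_map)
    moreover have "A = {1..n} \<or> (\<exists>i\<in>{1..n}. A = {i})"
      using * by (auto simp: full_or_subsingleton_def)
    ultimately show ?thesis using *(4) by auto
  qed
next
  fix X assume "X \<in> insert {Theta} (?C \<union> ?P)"
  then consider "X = {Theta}" | k where "k \<in> {1..n}" "X = (\<lambda>i. Pr i k) ` {1..n}"
    | i k where "i \<in> {1..n}" "k \<in> {1..n}" "X = {Pr i k}"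
    by auto
  then show "X \<in> ?L"
  proof cases
    case 1
    have "(\<lambda>a\<in>brandt n. Theta) \<in> const_maps n" by (simp add: const_mapsI)
    then show ?thesis
      using 1 const_maps_subset_affine_nsr by (force simp: R_invariant_def)
  next
    case (2 k)
    \<comment> \<open>Only the support matters, so the target column and the permutation are chosen
      as simply as possible.\<close>
    let ?f = "column_map n {1..n} k k id"
    have "map_supp n ?f = X" using 2 by (simp add: map_supp_column_map)
    moreover have "X \<noteq> {}" using 2 by auto
    ultimately have "R_invariant n ?f = X"
      using map_supp_nonconst[of ?f n] by (simp add: R_invariant_def)
    moreover have "?f \<in> affine_nsr n"
      using 2 by (intro full_column_map_in_affine_nsr permutes_id)
    ultimately show ?thesis by blast
  next
    case (3 i k)
    let ?f = "column_map n {i} k k id"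
    have "map_supp n ?f = X" using 3 by (simp add: map_supp_column_map)
    then have "R_invariant n ?f = X"
      using 3 map_supp_nonconst[of ?f n] by (simp add: R_invariant_def)
    \<comment> \<open>Adding the constant \<open>Pr i i\<close> on the left keeps only row
      \<open>i\<close> of the full column.\<close>
    moreover have "?f = map_add n (\<lambda>a\<in>brandt n. Pr i i) (column_map n {1..n} k k id)"
      by (rule brandt_map_eqI[of _ n]) (auto simp: column_map_Pr)
    moreover have "(\<lambda>a\<in>brandt n. Pr i i) \<in> affine_nsr n"
      using 3 const_maps_subset_affine_nsr const_mapsI[of "Pr i i" n] by auto
    moreover have "column_map n {1..n} k k id \<in> affine_nsr n"
      using 3 by (intro full_column_map_in_affine_nsr permutes_id)
    ultimately show ?thesis by (metis affine_nsr.add image_eqI)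
  qed
qed

lemma card_R_invariant_image:
  assumes "n \<ge> 2"
  shows "card (R_invariant n ` affine_nsr n) = n^2 + n + 1"
proof -
  let ?C = "(\<lambda>k. (\<lambda>i. Pr i k) ` {1..n}) ` {1..n}"
  let ?P = "(\<lambda>(i, k). {Pr i k}) ` ({1..n} \<times> {1..n})"
  have "inj_on (\<lambda>k. (\<lambda>i. Pr i k) ` {1..n}) {1..n}"
  proof (rule inj_onI)
    fix k l
    assume "(\<lambda>i. Pr i k) ` {1..n} = (\<lambda>i. Pr i l) ` {1..n}"
    moreover have "Pr 1 k \<in> (\<lambda>i. Pr i k) ` {1..n}" using assms by auto
    ultimately show "k = l" by auto
  qed
  then have C: "card ?C = n" by (simp add: card_image)
  have "inj_on (\<lambda>(i, k). {Pr i k}) ({1..n} \<times> {1..n})"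
    by (auto intro!: inj_onI)
  then have P: "card ?P = n^2" by (simp add: card_image power2_eq_square)
  have "?C \<inter> ?P = {}"
  proof (rule ccontr)
    assume "?C \<inter> ?P \<noteq> {}"
    then obtain k i l where "(\<lambda>i. Pr i k) ` {1..n} = {Pr i l}" by auto
    \<comment> \<open>Here \<open>n \<ge> 2\<close> enters: a column then has two different points,
      whereas for \<open>n = 1\<close> it coincides with a singleton.\<close>
    moreover have "Pr 1 k \<in> (\<lambda>i. Pr i k) ` {1..n}" "Pr 2 k \<in> (\<lambda>i. Pr i k) ` {1..n}"
      using assms by auto
    ultimately show False by auto
  qed
  then have "card (?C \<union> ?P) = n^2 + n"
    using C P by (simp add: card_Un_disjoint)
  moreover have "{Theta} \<notin> ?C \<union> ?P" by auto
  ultimately show ?thesis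
    by (simp add: R_invariant_image)
qed

theorem theorem4p4:
  fixes n :: nat
  assumes "n \<ge> 1"
  shows "(\<forall>f\<in>affine_nsr n. \<forall>g\<in>affine_nsr n.
            (f \<in> const_maps n \<and> g \<in> const_maps n \<longrightarrow> (f, g) \<in> affine_R n) \<and>
            (f \<notin> const_maps n \<and> g \<notin> const_maps n \<longrightarrow>
               ((f, g) \<in> affine_R n \<longleftrightarrow> map_supp n f = map_supp n g)))
         \<and> (n \<ge> 2 \<longrightarrow> card (affine_nsr n // affine_R n) = n^2 + n + 1)"
  using const_maps_affine_R affine_R_iff_map_supp
    card_quotient_invariant[OF affine_R_iff_R_invariant] card_R_invariant_image
  by simp

end
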